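(* For each integer $n\ge 0$ let \[ p_n := \frac{(-1)^n}{n+1}\, q_n . \] Then $(p_n)_{n\ge 0}$ is a sequence of monic polynomials forming an Appell sequence; that is, $p_n$ is monic of degree $n$ for every $n\ge 0$, and $p_n' = n\,p_{n-1}$ for every $n\ge 1$.
   Context: For each integer $n\ge 0$, the polynomial $q_n:\mathbb{R}\to\mathbb{R}$ is defined by \[ q_n(x) = (-1)^n \sum_{k\ \text{even},\ 0\le k\le n} \binom{n+1}{k+1} (-1)^{k/2} x^{n-k}, \] with the convention $x^0=1$ for all $x$. An Appell sequence is a sequence of polynomials $(p_n)_{n\ge 0}$ with $\deg p_n=n$ for all $n\ge 0$ and $p_n'=n\,p_{n-1}$ for all $n\ge 1$. *)

theory Defs
  imports Complex_Main "HOL-Computational_Algebra.Polynomial"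
begin

definition q :: "nat \<Rightarrow> real poly" where
  "q n = smult ((-1) ^ n)
     (\<Sum>k | even k \<and> k \<le> n. monom (real ((n + 1) choose (k + 1)) * (-1) ^ (k div 2)) (n - k))"

lemma poly_q:
  "poly (q n) x =
     (-1) ^ n * (\<Sum>k | even k \<and> k \<le> n. real ((n + 1) choose (k + 1)) * (-1) ^ (k div 2) * x ^ (n - k))"
  by (simp add: q_def poly_sum poly_monom)

(* The library sets degree 0 = 0 for the zero polynomial, so p n \<noteq> 0 is needed
   for "degree n" to have its usual meaning at n = 0. *)
definition appell_sequence :: "(nat \<Rightarrow> real poly) \<Rightarrow> bool" where
  "appell_sequence p \<longleftrightarrow>
     (\<forall>n. p n \<noteq> 0 \<and> degree (p n) = n) \<and>
     (\<forall>n\<ge>1. pderiv (p n) = smult (real n) (p (n - 1)))"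

end

theory Submission
  imports Defs
begin

text \<open>Differentiation sends \<open>q (Suc n)\<close> to \<open>-(n+2)\<close> times
  \<open>q n\<close>: the coefficients match by the absorption identity for binomials, and the signs
  \<open>(-1) ^ (k div 2)\<close> match because both sides use the same \<open>k\<close>. The factor
  \<open>(-1) ^ n / (n+1)\<close> turns this into the Appell relation and cancels the leading
  coefficient \<open>(-1) ^ n * (n+1)\<close>. The lemmas \<open>pderiv_q\<close> and
  \<open>lead_coeff_q\<close> carry this; both rest on \<open>coeff_q\<close>.\<close>

lemma coeff_q:
  "coeff (q n) m = (if m \<le> n \<and> even (n - m)
     then (-1) ^ n * (real ((n + 1) choose (n - m + 1)) * (-1) ^ ((n - m) div 2)) else 0)"
proof -
  let ?c = "\<lambda>k. real ((n + 1) choose (k + 1)) * (-1) ^ (k div 2)"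
  have "coeff (q n) m = (-1) ^ n * (\<Sum>k | even k \<and> k \<le> n. if n - k = m then ?c k else 0)"
    unfolding q_def coeff_smult coeff_sum coeff_monom ..
  \<comment> \<open>Only \<open>k = n - m\<close> can contribute. The guard \<open>m \<le> n\<close>
    is essential: for \<open>m > n\<close> truncated subtraction gives \<open>n - m = 0\<close>,
    which would wrongly select \<open>k = 0\<close>.\<close>
  also have "(\<Sum>k | even k \<and> k \<le> n. if n - k = m then ?c k else 0) =
      (\<Sum>k | even k \<and> k \<le> n. if k = n - m then (if m \<le> n then ?c k else 0) else 0)"
    by (rule sum.cong) auto
  also have "\<dots> = (if m \<le> n \<and> even (n - m) then ?c (n - m) else 0)"
    by (subst sum.delta) auto
  finally show ?thesis
    by (simp only: if_distrib[of "(*) ((-1) ^ n)"] mult_zero_right)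
qed

lemma lead_coeff_q: "coeff (q n) n = (-1) ^ n * (real n + 1)"
  by (simp add: coeff_q)

lemma degree_q: "degree (q n) = n"
proof (rule antisym)
  show "degree (q n) \<le> n"
    by (rule degree_le) (simp add: coeff_q)
  show "n \<le> degree (q n)"
    by (rule le_degree) (simp add: lead_coeff_q add_nonneg_eq_0_iff)
qed

text \<open>The index \<open>k = n - m\<close> is unchanged when \<open>n\<close> and
  \<open>m\<close> both grow by one, so only the binomials need comparing; the minus sign comes from
  the prefactor \<open>(-1) ^ Suc n\<close>.\<close>

lemma pderiv_q: "pderiv (q (Suc n)) = smult (- real (n + 2)) (q n)"
proof (rule poly_eqI)
  fix m
  show "coeff (pderiv (q (Suc n))) m = coeff (smult (- real (n + 2)) (q n)) m"
  proof (cases "m \<le> n")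
    case True
    \<comment> \<open>Absorption \<open>(N - k) * (N choose k) = N * ((N - 1) choose k)\<close> with
      \<open>N = n + 2\<close> and \<open>k = n - m + 1\<close>, where
      \<open>N - k = m + 1\<close>.\<close>
    then have "Suc m * ((n + 2) choose (n - m + 1)) = (n + 2) * ((n + 1) choose (n - m + 1))"
      using binomial_absorb_comp[of "n + 2" "n - m + 1"] by (simp add: Suc_diff_le)
    then have "real (Suc m) * real ((n + 2) choose (n - m + 1)) =
        real (n + 2) * real ((n + 1) choose (n - m + 1))"
      by (metis of_nat_mult)
    with True show ?thesis
      by (simp add: coeff_pderiv coeff_q mult.left_commute del: binomial_Suc_Suc of_nat_Suc)
  qed (simp add: coeff_pderiv coeff_q)
qed

theorem mainTheorem3:
  fixes p :: "nat \<Rightarrow> real poly"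
  assumes "\<And>n. p n = smult ((-1) ^ n / (real n + 1)) (q n)"
  shows "(\<forall>n. lead_coeff (p n) = 1) \<and> appell_sequence p"
proof -
  have pos: "real n + 1 \<noteq> 0" for n
    by linarith
  have deg: "degree (p n) = n" for n
    using pos[of n] by (simp add: assms degree_q)
  have lead: "coeff (p n) n = 1" for n
    using pos[of n] by (simp add: assms lead_coeff_q flip: power_mult_distrib)
  have nonzero: "p n \<noteq> 0" for n
    using lead[of n] by auto
  have deriv: "pderiv (p (Suc n)) = smult (real (Suc n)) (p n)" for n
  proof -
    have "(-1) ^ Suc n / (real (Suc n) + 1) * - real (n + 2) = real (Suc n) * ((-1) ^ n / (real n + 1))"
      using pos[of n] pos[of "Suc n"] by (simp add: divide_simps) (simp add: algebra_simps)
    then show ?thesis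
      by (simp only: assms pderiv_smult pderiv_q smult_smult)
  qed
  have "pderiv (p n) = smult (real n) (p (n - 1))" if "n \<ge> 1" for n
    using deriv[of "n - 1"] that by simp
  with deg lead nonzero show ?thesis
    by (simp add: appell_sequence_def)
qed

end
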